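(* Let $n\ge 3$ and $t\ge 0$ be integers, let $S_n^t$ be the sun with $t$ rays, and let $\mathcal{P}=\mathcal{P}(S_n^t)$ be the family of all paths (of all lengths) in $S_n^t$. Then $S_n^t$ is $\mathcal{P}$-EKR if and only if $t=0$; and when $t=0$ it is not strictly $\mathcal{P}$-EKR.
   Context: The sun $S_n^t$ is the graph with vertex set $\{v_i^j \mid 0\le i<n,\ 0\le j\le t\}$ and edges $v_i^0v_{i+1}^0$ for all $i$ (subscripts modulo $n$), together with $v_i^jv_i^0$ for all $i$ and all $0<j\le t$; i.e. it is an $n$-cycle with $t$ pendant vertices attached to each cycle vertex. A path is a subgraph (single vertices are allowed as paths, and distinct paths with the same vertex set are counted as distinct members of $\mathcal{P}$); intersections of paths are taken as intersections of their vertex sets. A family of paths is intersecting if any two of its members share a vertex, and it is a star if all its members share a common vertex. For a family $\mathcal{F}$ of paths and a vertex $x$, $\mathcal{F}_x=\{A\in\mathcal{F}\mid x\in V(A)\}$. A graph $G$ is $\mathcal{F}$-EKR, where $\mathcal{F}$ is a family of paths of $G$, if there is a vertex $x$ with $|\mathcal{F}_x|\ge|\mathcal{H}|$ for every intersecting $\mathcal{H}\subseteq\mathcal{F}$; it is strictly so if moreover every intersecting subfamily of $\mathcal{F}$ of maximum size is a star. *)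

theory Defs
  imports Main
begin

record 'a ugraph =
  verts :: "'a set"
  edges :: "'a set set"

definition simple_graph :: "'a ugraph \<Rightarrow> bool" where
  "simple_graph G \<longleftrightarrow> (\<forall>e \<in> edges G. e \<subseteq> verts G \<and> card e = 2)"

definition subgraph :: "'a ugraph \<Rightarrow> 'a ugraph \<Rightarrow> bool" where
  "subgraph H G \<longleftrightarrow> verts H \<subseteq> verts G \<and> edges H \<subseteq> edges G"

definition path_of_list :: "'a list \<Rightarrow> 'a ugraph" where
  "path_of_list p = \<lparr> verts = set p, edges = {{p ! i, p ! Suc i} | i. Suc i < length p} \<rparr>"

definition is_path :: "'a ugraph \<Rightarrow> bool" where
  "is_path H \<longleftrightarrow> (\<exists>p. p \<noteq> [] \<and> distinct p \<and> H = path_of_list p)"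

text \<open>A path is a subgraph, not a vertex sequence: a list and its reverse give the same path,
  whereas two paths on the same vertex set but with different edges are different members.\<close>

definition paths :: "'a ugraph \<Rightarrow> 'a ugraph set" where
  "paths G = {H. subgraph H G \<and> is_path H}"

definition intersecting :: "'a ugraph set \<Rightarrow> bool" where
  "intersecting \<F> \<longleftrightarrow> (\<forall>A \<in> \<F>. \<forall>B \<in> \<F>. verts A \<inter> verts B \<noteq> {})"

definition members_at :: "'a ugraph set \<Rightarrow> 'a \<Rightarrow> 'a ugraph set" where
  "members_at \<F> x = {A \<in> \<F>. x \<in> verts A}"

definition star :: "'a ugraph set \<Rightarrow> bool" where
  "star \<F> \<longleftrightarrow> (\<exists>x. \<forall>A \<in> \<F>. x \<in> verts A)"

text \<open>Sizes are measured with \<^const>\<open>card\<close>, so the next three definitions are meaningful only for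
  finite families; see \<open>finite_paths\<close> and \<open>finite_verts_sun\<close> below.\<close>

definition EKR :: "'a ugraph \<Rightarrow> 'a ugraph set \<Rightarrow> bool" where
  "EKR G \<F> \<longleftrightarrow>
     (\<exists>x \<in> verts G. \<forall>\<H>. \<H> \<subseteq> \<F> \<and> intersecting \<H> \<longrightarrow> card \<H> \<le> card (members_at \<F> x))"

definition maximum_intersecting :: "'a ugraph set \<Rightarrow> 'a ugraph set \<Rightarrow> bool" where
  "maximum_intersecting \<F> \<H> \<longleftrightarrow>
     \<H> \<subseteq> \<F> \<and> intersecting \<H> \<and>
     (\<forall>\<H>'. \<H>' \<subseteq> \<F> \<and> intersecting \<H>' \<longrightarrow> card \<H>' \<le> card \<H>)"

definition strictly_EKR :: "'a ugraph \<Rightarrow> 'a ugraph set \<Rightarrow> bool" where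
  "strictly_EKR G \<F> \<longleftrightarrow> EKR G \<F> \<and> (\<forall>\<H>. maximum_intersecting \<F> \<H> \<longrightarrow> star \<H>)"

text \<open>The pair \<open>(i, j)\<close> stands for \<open>v\<^sub>i\<^sup>j\<close>.\<close>

definition sun :: "nat \<Rightarrow> nat \<Rightarrow> (nat \<times> nat) ugraph" where
  "sun n t =
     \<lparr> verts = {(i, j) | i j. i < n \<and> j \<le> t},
       edges = {{(i, 0), (Suc i mod n, 0)} | i. i < n}
             \<union> {{(i, j), (i, 0)} | i j. i < n \<and> 0 < j \<and> j \<le> t} \<rparr>"

lemma finite_verts_sun: "finite (verts (sun n t))"
proof -
  have "verts (sun n t) = {..<n} \<times> {..t}" by (auto simp: sun_def)
  then show ?thesis by simp
qed

lemma simple_graph_sun: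
  assumes "n \<ge> 3"
  shows "simple_graph (sun n t)"
proof -
  have "Suc i mod n \<noteq> i" if "i < n" for i
    using assms that by (cases "Suc i = n") auto
  then have "card {(i, 0 :: nat), (Suc i mod n, 0)} = 2" if "i < n" for i
    using that by (metis card_2_iff prod.inject)
  then show ?thesis
    using assms by (auto simp: simple_graph_def sun_def)
qed

lemma finite_paths:
  assumes "finite (verts G)"
  shows "finite (paths G)"
proof (rule finite_subset)
  have "verts H \<in> Pow (verts G) \<and> edges H \<in> Pow (Pow (verts G))" if "H \<in> paths G" for H
    using that by (auto simp: paths_def subgraph_def is_path_def path_of_list_def)
      (metis Suc_lessD nth_mem subsetD)+
  then show "paths G \<subseteq> (\<lambda>(V, E). \<lparr> verts = V, edges = E \<rparr>) ` (Pow (verts G) \<times> Pow (Pow (verts G)))"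
    by (intro subsetI, rule_tac x = "(verts x, edges x)" in image_eqI) auto
  show "finite ((\<lambda>(V, E). \<lparr> verts = V, edges = E \<rparr>) ` (Pow (verts G) \<times> Pow (Pow (verts G))))"
    using assms by simp
qed

end

theory Submission
  imports Defs "HOL-Number_Theory.Cong"
begin

text \<open>In the cycle, a path missing the vertex \<open>x\<close> is an arc determined by its vertex set, and the
  complementary arc contains \<open>x\<close> and is disjoint from it. Hence replacing each member that misses
  \<open>x\<close> by its complement injects any intersecting family into the star at \<open>x\<close>.

  Conversely, modify the star at the cycle vertex \<open>x = v\<^sub>i\<^sup>0\<close> as follows: discard the paths
  that contain no other cycle vertex, and add the paths that avoid \<open>x\<close> but contain all other cycle
  vertices. The result is intersecting. The discarded paths are \<open>x\<close> with at most one pendant on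
  each side, and the added ones are the remaining arc with at most one pendant at each end. Both are
  given by two choices among \<open>t + 1\<close> possibilities, but taking the same pendant twice is impossible
  around \<open>x\<close>. So for \<open>t > 0\<close> the new family beats the star at \<open>x\<close>, which in turn is at
  least as large as the stars at the pendants of \<open>x\<close>. For \<open>t = 0\<close> it has the size of the
  star without being one.\<close>

section \<open>Paths as vertex lists\<close>

text \<open>Turns path membership into a condition on consecutive entries. The list is not unique:
  reversing it gives the same path.\<close>

definition path_list :: "'a ugraph \<Rightarrow> 'a list \<Rightarrow> bool" where
  "path_list G p \<longleftrightarrow> p \<noteq> [] \<and> distinct p \<and> set p \<subseteq> verts G \<and>
     successively (\<lambda>u v. {u, v} \<in> edges G) p"

lemma mem_paths_iff: "A \<in> paths G \<longleftrightarrow> (\<exists>p. path_list G p \<and> A = path_of_list p)"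
proof -
  have "subgraph (path_of_list p) G \<longleftrightarrow>
      set p \<subseteq> verts G \<and> successively (\<lambda>u v. {u, v} \<in> edges G) p" for p
    by (auto simp: subgraph_def path_of_list_def successively_conv_nth)
  then show ?thesis
    unfolding paths_def is_path_def path_list_def by blast
qed

lemma verts_path_of_list [simp]: "verts (path_of_list p) = set p"
  by (simp add: path_of_list_def)

lemma path_of_list_rev: "path_of_list (rev p) = path_of_list p"
proof -
  have sub: "edges (path_of_list (rev p)) \<subseteq> edges (path_of_list p)" for p :: "'a list"
  proof
    fix e assume "e \<in> edges (path_of_list (rev p))"
    then obtain k where k: "Suc k < length p" "e = {rev p ! k, rev p ! Suc k}"
      by (auto simp: path_of_list_def)
    \<comment> \<open>Mirrored position: the edge at \<open>k\<close> in \<open>rev p\<close> is the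
      edge at \<open>l\<close> in \<open>p\<close>.\<close>
    define l where "l = length p - Suc (Suc k)"
    have "rev p ! k = p ! Suc l" "rev p ! Suc k = p ! l" "Suc l < length p"
      using k(1) by (auto simp: rev_nth l_def Suc_diff_Suc)
    then show "e \<in> edges (path_of_list p)"
      using k(2) by (auto simp: path_of_list_def insert_commute)
  qed
  have "edges (path_of_list (rev p)) = edges (path_of_list p)"
    using sub[of p] sub[of "rev p"] by auto
  then show ?thesis
    by (simp add: path_of_list_def)
qed

lemma path_list_rev: "path_list G (rev p) \<longleftrightarrow> path_list G p"
  by (simp add: path_list_def insert_commute)

text \<open>Applied to pendants: a path through a pendant and some other vertex must contain the
  cycle vertex that carries it.\<close>

lemma path_list_neighbour:
  assumes "path_list G p" "u \<in> set p" "p \<noteq> [u]"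
  shows "\<exists>v \<in> set p. {u, v} \<in> edges G"
proof -
  obtain xs ys where p: "p = xs @ u # ys"
    using assms(2) by (meson split_list)
  show ?thesis
  proof (cases ys)
    case Nil
    with assms(3) p obtain zs v where "xs = zs @ [v]"
      by (metis append_Nil rev_exhaust)
    with assms(1) p show ?thesis
      by (auto simp: path_list_def successively_append_iff insert_commute)
  next
    case (Cons v zs)
    with assms(1) p show ?thesis
      by (auto simp: path_list_def successively_append_iff)
  qed
qed

section \<open>Arcs of the cycle\<close>

lemma verts_sun: "verts (sun n t) = {..<n} \<times> {..t}"
  by (auto simp: sun_def)

lemma edge_sun_iff:
  "{(a, b), (c, d)} \<in> edges (sun n t) \<longleftrightarrow>
     b = 0 \<and> d = 0 \<and> a < n \<and> c < n \<and> (c = Suc a mod n \<or> a = Suc c mod n) \<or>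
     a = c \<and> a < n \<and> (d = 0 \<and> 0 < b \<and> b \<le> t \<or> b = 0 \<and> 0 < d \<and> d \<le> t)"
  by (auto simp: sun_def doubleton_eq_iff)

text \<open>The start \<open>i\<close> may exceed \<open>n\<close>, so that a complementary arc can
  simply start at \<open>i + k\<close>.\<close>

definition arc :: "nat \<Rightarrow> nat \<Rightarrow> nat \<Rightarrow> (nat \<times> nat) list" where
  "arc n i k = map (\<lambda>j. ((i + j) mod n, 0)) [0..<k]"

lemma mod_add_inj:
  fixes i j k n :: nat
  assumes "(i + j) mod n = (i + k) mod n" "j < n" "k < n"
  shows "j = k"
  using assms by (metis cong_add_lcancel_nat cong_def mod_less)

lemma inj_on_arc:
  fixes i n :: nat
  shows "inj_on (\<lambda>j. ((i + j) mod n, 0 :: nat)) {..<n}"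
  by (rule inj_onI, rule mod_add_inj[of i _ n]) auto

lemma set_arc: "set (arc n i k) = (\<lambda>j. ((i + j) mod n, 0)) ` {..<k}"
  by (simp add: arc_def atLeast_upt)

lemma length_arc [simp]: "length (arc n i k) = k"
  by (simp add: arc_def)

lemma distinct_arc: "k \<le> n \<Longrightarrow> distinct (arc n i k)"
  using inj_on_subset[OF inj_on_arc[of i n], of "{..<k}"]
  by (simp add: arc_def distinct_map atLeast_upt)

lemma path_list_arc:
  assumes "0 < k" "k \<le> n"
  shows "path_list (sun n t) (arc n i k)"
  using assms distinct_arc[of k n i]
  by (auto simp: path_list_def set_arc verts_sun successively_conv_nth arc_def edge_sun_iff mod_Suc_eq)

lemma set_arc_full:
  assumes "0 < n"
  shows "set (arc n i n) = {..<n} \<times> {0}"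
proof (rule card_subset_eq)
  show "set (arc n i n) \<subseteq> {..<n} \<times> {0}"
    using assms by (auto simp: set_arc)
  show "card (set (arc n i n)) = card ({..<n} \<times> {0 :: nat})"
    using distinct_card[OF distinct_arc[of n n i]] by simp
qed simp

text \<open>Rotation by \<open>i\<close> is injective on offsets below \<open>n\<close>, so the
  complement is the image of the offsets from \<open>k\<close> to \<open>n - 1\<close>.\<close>

lemma set_arc_Compl:
  assumes "k \<le> n" "0 < n"
  shows "set (arc n (i + k) (n - k)) = {..<n} \<times> {0} - set (arc n i k)"
proof -
  let ?f = "\<lambda>j. ((i + j) mod n, 0 :: nat)"
  have "{..<n} \<times> {0} - set (arc n i k) = ?f ` {..<n} - ?f ` {..<k}"
    using set_arc_full[OF assms(2), of i] by (simp add: set_arc)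
  also have "\<dots> = ?f ` ({..<n} - {..<k})"
    using assms inj_on_arc[of i n] by (intro inj_on_image_set_diff[symmetric]) auto
  also have "{..<n} - {..<k} = (+) k ` {..<n - k}"
    using assms image_add_atLeastLessThan[of k 0 "n - k"] by (auto simp: lessThan_atLeast0)
  finally show ?thesis
    by (simp add: set_arc image_image add.assoc)
qed

lemma set_arc_remove:
  assumes "i < n"
  shows "set (arc n (i + 1) (n - 1)) = ({..<n} - {i}) \<times> {0}"
  using assms by (subst set_arc_Compl) (auto simp: set_arc)

text \<open>The start of a proper arc is recovered as its only vertex whose predecessor is missing.\<close>

lemma arc_eqI:
  assumes eq: "set (arc n i k) = set (arc n i' k')"
    and k: "0 < k" "k < n" "k' \<le> n" and i: "i < n" "i' < n"
  shows "arc n i k = arc n i' k'"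
proof -
  have "k = k'"
    using eq k distinct_card[OF distinct_arc[of k n i]] distinct_card[OF distinct_arc[of k' n i']]
    by simp
  with eq have "(i', 0) \<in> set (arc n i k)"
    using k i by (auto simp: set_arc image_iff intro!: bexI[of _ 0])
  then obtain j where j: "j < k" "i' = (i + j) mod n"
    by (auto simp: set_arc)
  show ?thesis
  proof (cases j)
    case 0
    with j i \<open>k = k'\<close> show ?thesis by simp
  next
    case (Suc l)
    have "((i + l) mod n, 0) \<in> set (arc n i' k')"
      unfolding eq[symmetric] using Suc j by (auto simp: set_arc)
    then obtain m where m: "m < k" "(i + l) mod n = (i' + m) mod n"
      using \<open>k = k'\<close> by (auto simp: set_arc)
    \<comment> \<open>The predecessor of \<open>i'\<close> would be \<open>Suc m\<close> steps after
      itself, impossible since \<open>Suc m\<close> \<le> \<open>k\<close> <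
      \<open>n\<close>.\<close>
    have "(i + l) mod n = (i + l + Suc m) mod n"
      using m(2) j(2) Suc by (simp add: mod_simps ac_simps)
    then have "(i + l + 0) mod n = (i + l + Suc m) mod n"
      by simp
    then have "0 = Suc m"
      by (rule mod_add_inj) (use m k in auto)
    then show ?thesis by simp
  qed
qed

text \<open>Each step moves one place forward or backward, and distinctness forbids turning round.
  So the direction is constant, and reversing the list if necessary makes it forward.\<close>

lemma paths_cycle_arc:
  assumes n: "n \<ge> 3" and A: "A \<in> paths (sun n 0)"
  obtains i k where "i < n" "0 < k" "k \<le> n" "A = path_of_list (arc n i k)"
proof -
  define up where "up p \<longleftrightarrow> (\<forall>k. Suc k < length p \<longrightarrow> fst (p ! Suc k) = Suc (fst (p ! k)) mod n)"
    for p :: "(nat \<times> nat) list"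
  have succ_inj: "a = b" if "Suc a mod n = Suc b mod n" "a < n" "b < n" for a b
    using mod_add_inj[of 1 a n b] that by simp
  obtain p where p: "path_list (sun n 0) p" "A = path_of_list p"
    using A by (auto simp: mem_paths_iff)
  have bd: "fst (p ! k) < n" "snd (p ! k) = 0" if "k < length p" for k
    using p(1) nth_mem[OF that] by (auto simp: path_list_def verts_sun)
  have step: "fst (p ! Suc k) = Suc (fst (p ! k)) mod n \<or> fst (p ! k) = Suc (fst (p ! Suc k)) mod n"
    if "Suc k < length p" for k
  proof -
    have "{p ! k, p ! Suc k} \<in> edges (sun n 0)"
      using p(1) that by (auto simp: path_list_def successively_conv_nth)
    then show ?thesis
      by (cases "p ! k"; cases "p ! Suc k") (auto simp: edge_sun_iff)
  qed
  have neq: "fst (p ! k) \<noteq> fst (p ! Suc (Suc k))" if "Suc (Suc k) < length p" for k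
  proof
    assume "fst (p ! k) = fst (p ! Suc (Suc k))"
    then have "p ! k = p ! Suc (Suc k)"
      using bd[of k] bd[of "Suc (Suc k)"] that by (simp add: prod_eq_iff)
    then show False
      using p(1) that by (auto simp: path_list_def nth_eq_iff_index_eq)
  qed
  have "up p \<or> up (rev p)"
  \<comment> \<open>The first step fixes the direction; a single vertex counts as forward.\<close>
  proof (cases "Suc 0 < length p \<longrightarrow> fst (p ! Suc 0) = Suc (fst (p ! 0)) mod n")
    case True
    have "Suc k < length p \<Longrightarrow> fst (p ! Suc k) = Suc (fst (p ! k)) mod n" for k
    proof (induction k)
      case (Suc k)
      then show ?case
        using step[of "Suc k"] neq[of k] bd[of k] bd[of "Suc (Suc k)"]
          succ_inj[of "fst (p ! k)" "fst (p ! Suc (Suc k))"] by auto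
    qed (use True in auto)
    then show ?thesis by (simp add: up_def)
  next
    case False
    have down: "Suc k < length p \<Longrightarrow> fst (p ! k) = Suc (fst (p ! Suc k)) mod n" for k
    proof (induction k)
      case (Suc k)
      then show ?case
        using step[of "Suc k"] neq[of k] by auto
    qed (use False step[of 0] in auto)
    have "fst (rev p ! Suc k) = Suc (fst (rev p ! k)) mod n" if "Suc k < length p" for k
      using down[of "length p - Suc (Suc k)"] that by (simp add: rev_nth Suc_diff_Suc)
    then show ?thesis by (simp add: up_def)
  qed
  then obtain q where q: "path_list (sun n 0) q" "A = path_of_list q" "up q"
    using p by (metis path_list_rev path_of_list_rev)
  have qbd: "fst (q ! k) < n" "snd (q ! k) = 0" if "k < length q" for k
    using q(1) nth_mem[OF that] by (auto simp: path_list_def verts_sun)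
  have pos: "0 < length q"
    using q(1) by (simp add: path_list_def)
  have "fst (q ! k) = (fst (q ! 0) + k) mod n" if "k < length q" for k
    using that
  proof (induction k)
    case (Suc k)
    then show ?case
      using q(3) by (simp add: up_def mod_Suc_eq)
  qed (use qbd(1) in auto)
  then have "q = arc n (fst (q ! 0)) (length q)"
    by (intro nth_equalityI) (auto simp: arc_def prod_eq_iff qbd)
  moreover have "length q \<le> n"
  proof -
    have "card (set q) \<le> card ({..<n} \<times> {..0 :: nat})"
      using q(1) by (intro card_mono) (auto simp: path_list_def verts_sun)
    then show ?thesis
      using q(1) by (simp add: path_list_def distinct_card)
  qed
  ultimately show thesis
    using that[of "fst (q ! 0)" "length q"] q(2) qbd(1)[of 0] pos by simp
qed

section \<open>The cycle\<close>

text \<open>The missing vertex rules out the arcs with \<open>k = n\<close>, which are different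
  paths on one vertex set.\<close>

lemma paths_cycle_eqI:
  assumes "n \<ge> 3" "A \<in> paths (sun n 0)" "B \<in> paths (sun n 0)"
    and eq: "verts A = verts B" and x: "x \<in> {..<n} \<times> {0}" "x \<notin> verts A"
  shows "A = B"
proof -
  obtain i k where A: "i < n" "0 < k" "k \<le> n" "A = path_of_list (arc n i k)"
    using assms by (metis paths_cycle_arc)
  obtain i' k' where B: "i' < n" "0 < k'" "k' \<le> n" "B = path_of_list (arc n i' k')"
    using assms by (metis paths_cycle_arc)
  have "k \<noteq> n"
    using A x set_arc_full[of n i] by auto
  then show ?thesis
    using arc_eqI[of n i k i' k'] A B eq by simp
qed

lemma paths_cycle_Compl:
  assumes "n \<ge> 3" "A \<in> paths (sun n 0)" and x: "x \<in> {..<n} \<times> {0}" "x \<notin> verts A"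
  obtains B where "B \<in> paths (sun n 0)" "verts B = {..<n} \<times> {0} - verts A"
proof -
  obtain i k where A: "i < n" "0 < k" "k \<le> n" "A = path_of_list (arc n i k)"
    using assms by (metis paths_cycle_arc)
  have "k \<noteq> n"
    using A x set_arc_full[of n i] by auto
  then have "path_list (sun n 0) (arc n (i + k) (n - k))"
    using A by (intro path_list_arc) auto
  then show thesis
    using that[of "path_of_list (arc n (i + k) (n - k))"] A by (auto simp: mem_paths_iff set_arc_Compl)
qed

lemma intersecting_cycle_card_le:
  assumes n: "n \<ge> 3" and x: "x \<in> {..<n} \<times> {0}"
    and H: "H \<subseteq> paths (sun n 0)" "intersecting H"
  shows "card H \<le> card (members_at (paths (sun n 0)) x)"
proof -
  \<comment> \<open>Used only for members missing \<open>x\<close>, where a complementary path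
    exists.\<close>
  define c where "c A = (SOME B. B \<in> paths (sun n 0) \<and> verts B = {..<n} \<times> {0} - verts A)"
    for A :: "(nat \<times> nat) ugraph"
  have c: "c A \<in> paths (sun n 0)" "verts (c A) = {..<n} \<times> {0} - verts A"
    if "A \<in> H" "x \<notin> verts A" for A
  proof -
    have "\<exists>B. B \<in> paths (sun n 0) \<and> verts B = {..<n} \<times> {0} - verts A"
      using that H paths_cycle_Compl[OF n _ x(1), of A] by blast
    then have "c A \<in> paths (sun n 0) \<and> verts (c A) = {..<n} \<times> {0} - verts A"
      unfolding c_def by (rule someI_ex)
    then show "c A \<in> paths (sun n 0)" "verts (c A) = {..<n} \<times> {0} - verts A"
      by auto
  qed
  have sub: "verts A \<subseteq> {..<n} \<times> {0}" if "A \<in> H" for A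
    using that H(1) by (auto simp: paths_def subgraph_def verts_sun)
  \<comment> \<open>\<open>c B\<close> is disjoint from \<open>B\<close>, so it cannot belong to
    \<open>H\<close>. This settles the mixed case of injectivity.\<close>
  have not_c: "A \<noteq> c B" if "A \<in> H" "B \<in> H" "x \<notin> verts B" for A B
    using that H(2) c(2)[OF that(2,3)] by (auto simp: intersecting_def)
  define \<phi> where "\<phi> A = (if x \<in> verts A then A else c A)" for A
  have "inj_on \<phi> H"
  proof (rule inj_onI)
    fix A B assume AB: "A \<in> H" "B \<in> H" and eq: "\<phi> A = \<phi> B"
    show "A = B"
    proof (cases "x \<in> verts A \<or> x \<in> verts B")
      case True
      then show ?thesis
        using eq not_c[OF AB] not_c[OF AB(2,1)] unfolding \<phi>_def by (metis (full_types))
    next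
      case False
      then have "{..<n} \<times> {0} - verts A = {..<n} \<times> {0} - verts B"
        using eq c(2)[OF AB(1)] c(2)[OF AB(2)] by (simp add: \<phi>_def)
      then have "verts A = verts B"
        using sub[OF AB(1)] sub[OF AB(2)] by blast
      then show ?thesis
        using paths_cycle_eqI[OF n] AB False H(1) x by blast
    qed
  qed
  moreover have "\<phi> ` H \<subseteq> members_at (paths (sun n 0)) x"
    using H(1) c x by (auto simp: \<phi>_def members_at_def)
  moreover have "finite (members_at (paths (sun n 0)) x)"
    using finite_paths[OF finite_verts_sun] by (simp add: members_at_def)
  ultimately show ?thesis
    by (rule card_inj_on_le)
qed

section \<open>Trading local paths for paths around the rest of the cycle\<close>

text \<open>Index \<open>0\<close> stands for attaching no pendant vertex.\<close>

definition pendant :: "nat \<Rightarrow> nat \<Rightarrow> (nat \<times> nat) list" where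
  "pendant i a = (if a = 0 then [] else [(i, a)])"

text \<open>Excluding foreign pendants as well changes nothing: a path through \<open>(i, 0)\<close>
  reaches them only via their cycle vertices.\<close>

definition local_paths :: "nat \<Rightarrow> nat \<Rightarrow> nat \<Rightarrow> (nat \<times> nat) ugraph set" where
  "local_paths n t i = {A \<in> members_at (paths (sun n t)) (i, 0). verts A \<subseteq> {i} \<times> UNIV}"

text \<open>The arc ends at the predecessor of \<open>i\<close>, written \<open>i + (n - 1)\<close>
  to avoid truncated subtraction at \<open>i = 0\<close>.\<close>

definition detour_list :: "nat \<Rightarrow> nat \<Rightarrow> nat \<times> nat \<Rightarrow> (nat \<times> nat) list" where
  "detour_list n i = (\<lambda>(a, b). pendant ((i + 1) mod n) a @ arc n (i + 1) (n - 1) @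
     pendant ((i + (n - 1)) mod n) b)"

definition detours :: "nat \<Rightarrow> nat \<Rightarrow> nat \<Rightarrow> (nat \<times> nat) ugraph set" where
  "detours n t i = (path_of_list \<circ> detour_list n i) ` ({..t} \<times> {..t})"

definition traded :: "nat \<Rightarrow> nat \<Rightarrow> nat \<Rightarrow> (nat \<times> nat) ugraph set" where
  "traded n t i = members_at (paths (sun n t)) (i, 0) - local_paths n t i \<union> detours n t i"

text \<open>For \<open>n = 2\<close> both neighbours of \<open>i\<close> would coincide. Keeping
  them apart prevents the two end pendants from colliding.\<close>

lemma detour_ends:
  fixes n i :: nat
  assumes "n \<ge> 3" "i < n"
  shows "(i + 1) mod n \<noteq> i" "(i + (n - 1)) mod n \<noteq> i" "(i + 1) mod n \<noteq> (i + (n - 1)) mod n"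
  using assms mod_add_inj[of i 1 n 0] mod_add_inj[of i "n - 1" n 0] mod_add_inj[of i 1 n "n - 1"]
  by auto

lemma set_detour_list:
  assumes "i < n"
  shows "set (detour_list n i (a, b)) = ({..<n} - {i}) \<times> {0} \<union>
    set (pendant ((i + 1) mod n) a) \<union> set (pendant ((i + (n - 1)) mod n) b)"
  using set_arc_remove[OF assms] by (auto simp: detour_list_def)

lemma path_list_detour:
  assumes n: "n \<ge> 3" "i < n" and ab: "a \<le> t" "b \<le> t"
  shows "path_list (sun n t) (detour_list n i (a, b))"
proof -
  let ?c = "arc n (i + 1) (n - 1)"
  have c: "path_list (sun n t) ?c"
    using n by (intro path_list_arc) auto
  have ne: "?c \<noteq> []"
    using n by (auto simp: arc_def)
  have hd: "hd ?c = ((i + 1) mod n, 0)"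
    using n by (simp add: arc_def hd_map)
  have last: "last ?c = ((i + (n - 1)) mod n, 0)"
  proof -
    obtain m where "n = Suc (Suc m)"
      using n by (cases n; cases "n - 1") auto
    then show ?thesis
      by (simp add: arc_def last_map)
  qed
  show ?thesis
    using c ne hd last n ab set_arc_remove[OF n(2)] detour_ends[OF n]
    by (auto simp: path_list_def detour_list_def pendant_def successively_append_iff
        successively_Cons verts_sun edge_sun_iff)
qed

text \<open>The vertex set alone reveals \<open>a\<close> and \<open>b\<close>: they are the
  positive heights occurring over the two ends, or 0 if there is none.\<close>

lemma inj_on_detours:
  assumes n: "n \<ge> 3" "i < n"
  shows "inj_on (path_of_list \<circ> detour_list n i) ({..t} \<times> {..t})"
proof (rule inj_onI, clarify)
  fix a b a' b'
  assume "(path_of_list \<circ> detour_list n i) (a, b) = (path_of_list \<circ> detour_list n i) (a', b')"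
  then have eq: "set (detour_list n i (a, b)) = set (detour_list n i (a', b'))"
    by (metis comp_apply verts_path_of_list)
  have "((i + 1) mod n, j) \<in> set (detour_list n i (a, b)) \<longleftrightarrow> j = a"
    "((i + (n - 1)) mod n, j) \<in> set (detour_list n i (a, b)) \<longleftrightarrow> j = b"
    if "j > 0" for j a b
    using that detour_ends[OF n] by (auto simp: set_detour_list[OF n(2)] pendant_def)
  then show "a = a' \<and> b = b'"
    using eq by (metis neq0_conv)
qed

lemma card_detours:
  assumes "n \<ge> 3" "i < n"
  shows "card (detours n t i) = Suc t * Suc t"
  unfolding detours_def using card_image[OF inj_on_detours[OF assms]] by simp

text \<open>An upper bound suffices, so it does not matter that \<open>(a, b)\<close> and
  \<open>(b, a)\<close> give the same path. The pair \<open>(1, 1)\<close> would use one pendant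
  twice; for \<open>t = 0\<close> it lies outside the square and nothing is removed.\<close>

lemma card_local_paths:
  "card (local_paths n t i) \<le> card ({..t} \<times> {..t} - {(1, 1)})"
proof -
  let ?g = "\<lambda>(a, b). path_of_list (pendant i a @ (i, 0) # pendant i b)"
  \<comment> \<open>Pendants are never adjacent, so each side of \<open>(i, 0)\<close> holds at most
    one.\<close>
  have short: "xs = [] \<or> (\<exists>a. xs = [(i, a)] \<and> 0 < a \<and> a \<le> t)"
    if "successively (\<lambda>u v. {u, v} \<in> edges (sun n t)) xs" "set xs \<subseteq> {i} \<times> {0<..t}" for xs
    using that
    by (cases xs rule: remdups_adj.cases) (auto simp: edge_sun_iff)
  have "local_paths n t i \<subseteq> ?g ` ({..t} \<times> {..t} - {(1, 1)})"
  proof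
    fix A assume "A \<in> local_paths n t i"
    then obtain p where p: "path_list (sun n t) p" "A = path_of_list p"
      "(i, 0) \<in> set p" "set p \<subseteq> {i} \<times> UNIV"
      by (auto simp: local_paths_def members_at_def mem_paths_iff)
    obtain us vs where p_eq: "p = us @ (i, 0) # vs"
      using p(3) by (meson split_list)
    have 1: "distinct p" "set p \<subseteq> {i} \<times> {..t}"
      using p by (auto simp: path_list_def verts_sun)
    then have "set us \<subseteq> {i} \<times> {0<..t}" "set vs \<subseteq> {i} \<times> {0<..t}"
      unfolding p_eq by (auto intro!: gr0I)
    moreover have "successively (\<lambda>u v. {u, v} \<in> edges (sun n t)) us"
      "successively (\<lambda>u v. {u, v} \<in> edges (sun n t)) vs"
      using p(1) unfolding p_eq path_list_def
      by (auto simp: successively_append_iff successively_Cons)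
    ultimately have us: "us = [] \<or> (\<exists>a. us = [(i, a)] \<and> 0 < a \<and> a \<le> t)"
      and vs: "vs = [] \<or> (\<exists>a. vs = [(i, a)] \<and> 0 < a \<and> a \<le> t)"
      using short by blast+
    obtain a where a: "us = pendant i a" "a \<le> t"
      using us by (force simp: pendant_def)
    obtain b where b: "vs = pendant i b" "b \<le> t"
      using vs by (force simp: pendant_def)
    have "(a, b) \<noteq> (1, 1)"
      using 1(1) a b by (auto simp: p_eq pendant_def)
    then show "A \<in> ?g ` ({..t} \<times> {..t} - {(1, 1)})"
      using a b p(2) p_eq by (intro image_eqI[of _ _ "(a, b)"]) auto
  qed
  then show ?thesis
    by (intro surj_card_le) auto
qed

lemma traded_subset:
  assumes "n \<ge> 3" "i < n"
  shows "traded n t i \<subseteq> paths (sun n t)"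
proof -
  have "path_of_list (detour_list n i (a, b)) \<in> paths (sun n t)" if "a \<le> t" "b \<le> t" for a b
    using path_list_detour[OF assms that] by (auto simp: mem_paths_iff)
  then show ?thesis
    by (auto simp: traded_def detours_def members_at_def)
qed

text \<open>Remaining star members share \<open>(i, 0)\<close>, and detours share all other cycle
  vertices. A remaining star member contains one of those other cycle vertices, hence meets every
  detour.\<close>

lemma intersecting_traded:
  assumes n: "n \<ge> 3" "i < n"
  shows "intersecting (traded n t i)"
proof -
  have detour: "({..<n} - {i}) \<times> {0} \<subseteq> verts D" if "D \<in> detours n t i" for D
    using that set_detour_list[OF n(2)] by (auto simp: detours_def)
  have star: "\<exists>j \<in> {..<n} - {i}. (j, 0) \<in> verts A"
    if "A \<in> members_at (paths (sun n t)) (i, 0) - local_paths n t i" for A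
  proof -
    have "A \<in> paths (sun n t)" "(i, 0) \<in> verts A" "\<not> verts A \<subseteq> {i} \<times> UNIV"
      using that by (auto simp: local_paths_def members_at_def)
    then obtain p where p: "path_list (sun n t) p" "A = path_of_list p" "(i, 0) \<in> set p"
      "\<not> set p \<subseteq> {i} \<times> UNIV"
      by (metis mem_paths_iff verts_path_of_list)
    then obtain j a where j: "(j, a) \<in> set p" "j \<noteq> i"
      by auto
    have "j < n"
      using j p(1) by (auto simp: path_list_def verts_sun)
    \<comment> \<open>If \<open>(j, a)\<close> is a pendant, its neighbour on the path can only be
      \<open>(j, 0)\<close>.\<close>
    have "(j, 0) \<in> set p"
    proof (cases "a = 0")
      case False
      have "p \<noteq> [(j, a)]"
        using p(3) j(2) by auto
      then obtain v where "v \<in> set p" "{(j, a), v} \<in> edges (sun n t)"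
        using path_list_neighbour[OF p(1) j(1)] by blast
      with False show ?thesis
        by (cases v) (auto simp: edge_sun_iff)
    qed (use j in auto)
    with j p \<open>j < n\<close> show ?thesis by auto
  qed
  obtain j where j: "j \<in> {..<n} - {i}"
    using that[of "(i + 1) mod n"] detour_ends(1)[OF n] n by auto
  show ?thesis
    unfolding intersecting_def
  proof (intro ballI)
    fix A B assume AB: "A \<in> traded n t i" "B \<in> traded n t i"
    consider "A \<in> detours n t i" "B \<in> detours n t i"
      | "A \<in> detours n t i" "B \<in> members_at (paths (sun n t)) (i, 0) - local_paths n t i"
      | "A \<in> members_at (paths (sun n t)) (i, 0) - local_paths n t i" "B \<in> detours n t i"
      | "(i, 0) \<in> verts A" "(i, 0) \<in> verts B"
      using AB by (auto simp: traded_def members_at_def)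
    then show "verts A \<inter> verts B \<noteq> {}"
    proof cases
      case 1
      then have "(j, 0) \<in> verts A" "(j, 0) \<in> verts B"
        using detour j by blast+
      then show ?thesis by blast
    next
      case 2
      then show ?thesis using star[of B] detour[of A] by blast
    next
      case 3
      then show ?thesis using star[of A] detour[of B] by blast
    qed blast
  qed
qed

text \<open>Bounds the gain of the trade from below, in additive form to avoid truncated
  subtraction. One inequality serves both cases: the two squares differ in size exactly when
  \<open>t > 0\<close>.\<close>

lemma card_traded:
  assumes n: "n \<ge> 3" "i < n"
  shows "card (members_at (paths (sun n t)) (i, 0)) + card ({..t} \<times> {..t}) \<le>
    card (traded n t i) + card ({..t} \<times> {..t} - {(1, 1)})"
proof -
  let ?S = "members_at (paths (sun n t)) (i, 0)"
  have fin: "finite ?S"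
    using finite_paths[OF finite_verts_sun] by (simp add: members_at_def)
  have sub: "local_paths n t i \<subseteq> ?S"
    by (auto simp: local_paths_def)
  \<comment> \<open>Detours avoid \<open>(i, 0)\<close>, so all of them are new to the star.\<close>
  have "(i, 0) \<notin> verts D" if "D \<in> detours n t i" for D
    using that set_detour_list[OF n(2)] detour_ends[OF n]
    by (auto simp: detours_def pendant_def split: if_splits)
  then have "?S \<inter> detours n t i = {}"
    by (auto simp: members_at_def)
  then have "card (traded n t i) = card (?S - local_paths n t i) + card (detours n t i)"
    unfolding traded_def using fin by (intro card_Un_disjoint) (auto simp: detours_def)
  moreover have "card (?S - local_paths n t i) = card ?S - card (local_paths n t i)"
    using fin sub by (meson card_Diff_subset finite_subset)
  moreover have "card (local_paths n t i) \<le> card ?S"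
    using fin sub by (rule card_mono)
  ultimately show ?thesis
    using card_local_paths[of n t i] card_detours[OF n, of t] by simp
qed

text \<open>Every path through a pendant passes through its cycle vertex, except the pendant alone.
  That exception is offset by the one-vertex path at \<open>(i, 0)\<close>, which misses the
  pendant.\<close>

lemma card_pendant_star_le:
  assumes n: "i < n" and a: "a \<le> t"
  shows "card (members_at (paths (sun n t)) (i, a)) \<le> card (members_at (paths (sun n t)) (i, 0))"
proof (cases "a = 0")
  case False
  let ?S = "members_at (paths (sun n t)) (i, 0)"
  let ?v = "path_of_list [(i, 0 :: nat)]"
  have fin: "finite ?S"
    using finite_paths[OF finite_verts_sun] by (simp add: members_at_def)
  have v: "?v \<in> ?S"
    using n by (auto simp: members_at_def mem_paths_iff path_list_def verts_sun intro!: exI[of _ "[(i, 0)]"])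
  have "members_at (paths (sun n t)) (i, a) \<subseteq> insert (path_of_list [(i, a)]) (?S - {?v})"
  proof
    fix A assume A: "A \<in> members_at (paths (sun n t)) (i, a)"
    then obtain p where p: "path_list (sun n t) p" "A = path_of_list p" "(i, a) \<in> set p"
      by (auto simp: members_at_def mem_paths_iff)
    show "A \<in> insert (path_of_list [(i, a)]) (?S - {?v})"
    proof (cases "p = [(i, a)]")
      case neq: False
      then obtain w where "w \<in> set p" "{(i, a), w} \<in> edges (sun n t)"
        using path_list_neighbour[OF p(1,3)] by blast
      with False have "(i, 0) \<in> set p"
        by (cases w) (auto simp: edge_sun_iff)
      moreover have "A \<noteq> ?v"
      proof
        assume "A = ?v"
        then have "verts A = {(i, 0)}" by simp
        with p(2,3) False show False by simp
      qed
      ultimately show ?thesis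
        using A p(2) by (simp add: members_at_def)
    qed (use p in simp)
  qed
  then have "card (members_at (paths (sun n t)) (i, a)) \<le> card (insert (path_of_list [(i, a)]) (?S - {?v}))"
    using fin by (intro card_mono) auto
  also have "\<dots> \<le> Suc (card (?S - {?v}))"
    by (rule card_insert_le_m1) auto
  also have "\<dots> = card ?S"
    by (rule card_Suc_Diff1[OF fin v])
  finally show ?thesis .
qed simp

section \<open>The sun with pendants\<close>

lemma not_EKR_sun:
  assumes n: "n \<ge> 3" and t: "t > 0"
  shows "\<not> EKR (sun n t) (paths (sun n t))"
proof
  assume "EKR (sun n t) (paths (sun n t))"
  then obtain i a where x: "i < n" "a \<le> t" and max:
    "\<And>H. H \<subseteq> paths (sun n t) \<Longrightarrow> intersecting H \<Longrightarrow>
       card H \<le> card (members_at (paths (sun n t)) (i, a))"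
    unfolding EKR_def verts_sun by blast
  \<comment> \<open>Here \<open>t > 0\<close> puts \<open>(1, 1)\<close> into the square, so the
    trade is a strict gain.\<close>
  have "card ({..t} \<times> {..t} - {(1, 1)}) < card ({..t} \<times> {..t})"
    using t by (intro card_Diff1_less) auto
  then have "card (members_at (paths (sun n t)) (i, 0)) < card (traded n t i)"
    using card_traded[OF n x(1), of t] by linarith
  also have "\<dots> \<le> card (members_at (paths (sun n t)) (i, a))"
    by (intro max traded_subset intersecting_traded n x)
  finally show False
    using card_pendant_star_le[OF x] by simp
qed

section \<open>The cycle: EKR holds, but not strictly\<close>

lemma EKR_cycle:
  assumes "n \<ge> 3"
  shows "EKR (sun n 0) (paths (sun n 0))"
  unfolding EKR_def using assms intersecting_cycle_card_le[of n "(0, 0)"]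
  by (intro bexI[of _ "(0, 0)"]) (auto simp: verts_sun)

text \<open>The two-vertex arcs on either side of \<open>(0, 0)\<close> survive the trade and meet
  only there, while the detour avoids that vertex.\<close>

lemma not_star_traded_cycle:
  assumes n: "n \<ge> 3"
  shows "\<not> star (traded n 0 0)"
proof
  assume "star (traded n 0 0)"
  then obtain x where x: "\<And>A. A \<in> traded n 0 0 \<Longrightarrow> x \<in> verts A"
    by (auto simp: star_def)
  have arc: "path_of_list (arc n i 2) \<in> traded n 0 0"
    if "(0, 0) \<in> set (arc n i 2)" "\<not> set (arc n i 2) \<subseteq> {0} \<times> UNIV" for i
    using that n path_list_arc[of 2 n 0 i]
    by (auto simp: traded_def local_paths_def members_at_def mem_paths_iff)
  have s1: "set (arc n 0 2) = {(0, 0), (1, 0)}"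
    and s2: "set (arc n (n - 1) 2) = {(n - 1, 0), (0, 0)}"
    using n by (auto simp: set_arc numeral_2_eq_2 lessThan_Suc)
  have "x \<in> set (arc n 0 2)" "x \<in> set (arc n (n - 1) 2)"
    using x[OF arc[of 0]] x[OF arc[of "n - 1"]] n by (simp_all add: s1 s2[unfolded One_nat_def])
  then have "x = (0, 0)"
    using n unfolding s1 s2 by auto
  have "path_of_list (detour_list n 0 (0, 0)) \<in> traded n 0 0"
    by (force simp: traded_def detours_def)
  then have "x \<in> set (detour_list n 0 (0, 0))"
    using x by fastforce
  then show False
    using \<open>x = (0, 0)\<close> n by (auto simp: set_detour_list pendant_def)
qed

lemma not_strictly_EKR_cycle:
  assumes n: "n \<ge> 3"
  shows "\<not> strictly_EKR (sun n 0) (paths (sun n 0))"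
proof -
  have "card H \<le> card (traded n 0 0)" if "H \<subseteq> paths (sun n 0)" "intersecting H" for H
  proof -
    have "card H \<le> card (members_at (paths (sun n 0)) (0, 0))"
      using that n by (intro intersecting_cycle_card_le) auto
    \<comment> \<open>For \<open>t = 0\<close> the removed pair is absent, so the trade loses
      nothing and the family attains the star bound.\<close>
    also have "\<dots> \<le> card (traded n 0 0)"
      using card_traded[OF n, of 0 0] n by simp
    finally show ?thesis .
  qed
  then have "maximum_intersecting (paths (sun n 0)) (traded n 0 0)"
    using n by (auto simp: maximum_intersecting_def intersecting_traded dest: traded_subset[THEN subsetD, rotated 2])
  then show ?thesis
    using not_star_traded_cycle[OF n] by (auto simp: strictly_EKR_def)
qed

theorem theorem11:
  fixes n t :: nat
  assumes "n \<ge> 3"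
  shows "(EKR (sun n t) (paths (sun n t)) \<longleftrightarrow> t = 0) \<and>
         (t = 0 \<longrightarrow> \<not> strictly_EKR (sun n t) (paths (sun n t)))"
  using assms EKR_cycle not_EKR_sun not_strictly_EKR_cycle by blast

end
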